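(* Let $\alpha\in(0,1)\setminus\mathbb{Q}$ and suppose that $\operatorname{exit}(\alpha)=N<\infty$. Then $$\operatorname{dist}(\alpha,\mathcal{C})=3^{-(N-1)}\operatorname{dist}\!\left(\theta_{N-1},\{1/3,2/3\}\right).$$
   Context: $\mathcal{C}\subseteq[0,1]$ is the middle-third Cantor set, and $\operatorname{dist}(x,A)=\inf_{y\in A}|x-y|$. Let $M=[1/3,2/3)$. For an irrational $\alpha\in(0,1)$ and an integer $n\ge 0$, $\theta_n=\{3^n\alpha\}$ is the fractional part of $3^n\alpha$. The exit time of $\alpha$ is $\operatorname{exit}(\alpha)=\inf\{N\ge 1:\theta_{N-1}\in M\}\in\mathbb{N}\cup\{\infty\}$ (with $\inf\emptyset=\infty$), i.e. the position of the first digit $1$ in the ternary expansion of $\alpha$. *)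

theory Defs
  imports "HOL-Analysis.Analysis" "HOL-Library.Extended_Nat"
begin

text \<open>Level \<open>n\<close> of the middle-third construction: the second clause
  places two copies of the previous level, scaled by one third, in the left and right thirds
  of the unit interval.\<close>

primrec cantor_level :: "nat \<Rightarrow> real set" where
  "cantor_level 0 = {0..1}"
| "cantor_level (Suc n) =
     (\<lambda>x. x / 3) ` cantor_level n \<union> (\<lambda>x. (x + 2) / 3) ` cantor_level n"

definition cantor_set :: "real set" where
  "cantor_set = (\<Inter>n. cantor_level n)"

definition theta :: "real \<Rightarrow> nat \<Rightarrow> real" where
  "theta \<alpha> n = frac (3 ^ n * \<alpha>)"

definition middle_third :: "real set" where
  "middle_third = {1/3..<2/3}"

text \<open>The infimum is taken in \<open>enat\<close>, where \<open>Inf {} = \<infinity>\<close>.\<close>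

definition exit_time :: "real \<Rightarrow> enat" where
  "exit_time \<alpha> = Inf {enat N | N. N \<ge> 1 \<and> theta \<alpha> (N - 1) \<in> middle_third}"

end

theory Submission
  imports Defs
begin

text \<open>The Cantor set is the union of two copies of itself, scaled by one third: one in
  \<open>[0, 1/3]\<close> and one in \<open>[2/3, 1]\<close>. A point of \<open>[0, 1/3]\<close> is nearest to the left copy, because
  the endpoint \<open>1/3\<close> of that copy is at least as close as anything on the right; likewise for
  \<open>[2/3, 1]\<close>. Outside the middle third, distances to the Cantor set are therefore computed
  inside one copy, and undoing the scaling (which is the map \<open>x \<mapsto> frac (3 x)\<close>) multiplies the
  distance by \<open>3\<close>: this is \<open>infdist_cantor_set_frac\<close>. Inside the middle third, which the Cantor
  set meets at most in an endpoint, the nearest points are the endpoints \<open>1/3\<close> and \<open>2/3\<close>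
  (\<open>infdist_cantor_set_middle_third\<close>).

  The orbit \<open>theta \<alpha>\<close> iterates \<open>x \<mapsto> frac (3 x)\<close>, and its first entry into the middle third
  occurs at the index one below the exit time. Each step before that contributes one factor
  \<open>1/3\<close>, and the endpoint formula applies at the entry.\<close>

section \<open>Distances to images and unions\<close>

lemma infdist_similarity_image:
  fixes f :: "'a::metric_space \<Rightarrow> 'b::metric_space"
  assumes f: "\<And>x y. dist (f x) (f y) = c * dist x y" and c: "c > 0" and "A \<noteq> {}"
  shows "infdist (f x) (f ` A) = c * infdist x A"
proof (rule antisym)
  have "infdist (f x) (f ` A) / c \<le> dist x y" if "y \<in> A" for y
    using infdist_le[of "f y" "f ` A" "f x"] that c by (simp add: f field_simps)
  then have "infdist (f x) (f ` A) / c \<le> infdist x A"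
    using \<open>A \<noteq> {}\<close> by (auto simp: infdist_notempty intro!: cINF_greatest)
  then show "infdist (f x) (f ` A) \<le> c * infdist x A"
    using c by (simp add: field_simps)
next
  have "c * infdist x A \<le> dist (f x) z" if "z \<in> f ` A" for z
    using that c by (auto simp: f infdist_le)
  then show "c * infdist x A \<le> infdist (f x) (f ` A)"
    using \<open>A \<noteq> {}\<close> by (subst infdist_notempty) (auto intro!: cINF_greatest)
qed

lemma infdist_Un_eq_left:
  assumes "p \<in> A" and far: "\<And>b. b \<in> B \<Longrightarrow> dist x p \<le> dist x b"
  shows "infdist x (A \<union> B) = infdist x A"
proof (cases "B = {}")
  case False
  then have "infdist x B \<ge> dist x p"
    using far by (auto simp: infdist_notempty intro!: cINF_greatest)
  moreover have "infdist x A \<le> dist x p"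
    using \<open>p \<in> A\<close> by (rule infdist_le)
  ultimately show ?thesis
    using False \<open>p \<in> A\<close> by (subst infdist_Un_min) auto
qed simp

section \<open>Self-similarity of the Cantor set\<close>

lemma cantor_level_subset_unit: "cantor_level n \<subseteq> {0..1}"
  by (induction n) force+

lemma cantor_set_subset_unit: "cantor_set \<subseteq> {0..1}"
  using cantor_level_subset_unit by (auto simp: cantor_set_def)

lemma zero_one_in_cantor_level: "0 \<in> cantor_level n \<and> 1 \<in> cantor_level n"
  by (induction n) (auto simp: image_iff intro: bexI[where x = 0] bexI[where x = 1])

lemma zero_in_cantor_set: "0 \<in> cantor_set" and one_in_cantor_set: "1 \<in> cantor_set"
  using zero_one_in_cantor_level by (auto simp: cantor_set_def)

lemma mem_image_left_copy: "x \<in> (\<lambda>x. x / 3) ` A \<longleftrightarrow> 3 * x \<in> A" for x :: real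
  by (force simp: image_iff mult.commute[of 3])

lemma mem_image_right_copy: "x \<in> (\<lambda>x. (x + 2) / 3) ` A \<longleftrightarrow> 3 * x - 2 \<in> A" for x :: real
proof -
  have "x = (y + 2) / 3 \<longleftrightarrow> y = 3 * x - 2" for y
    by auto
  then show ?thesis
    by (simp add: image_iff)
qed

lemma mem_cantor_level_Suc:
  "x \<in> cantor_level (Suc n) \<longleftrightarrow> 3 * x \<in> cantor_level n \<or> 3 * x - 2 \<in> cantor_level n"
  by (simp add: mem_image_left_copy mem_image_right_copy)

lemma mem_cantor_set_iff: "x \<in> cantor_set \<longleftrightarrow> (\<forall>n. x \<in> cantor_level (Suc n))"
proof
  assume *: "\<forall>n. x \<in> cantor_level (Suc n)"
  \<comment> \<open>Level \<open>1\<close> lies in the unit interval, which is level \<open>0\<close>.\<close>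
  have "x \<in> cantor_level 0"
    using * cantor_level_subset_unit[of "Suc 0"] by (auto simp del: cantor_level.simps(2))
  then have "x \<in> cantor_level n" for n
    using * by (cases n) blast+
  then show "x \<in> cantor_set"
    by (simp add: cantor_set_def)
qed (auto simp: cantor_set_def simp del: cantor_level.simps)

text \<open>The two copies are separated by the middle third, so a given point uses the same clause
  of the recursion at every level; hence the disjunction commutes with the intersection over
  the levels.\<close>

lemma mem_cantor_set_unfold:
  "x \<in> cantor_set \<longleftrightarrow> 3 * x \<in> cantor_set \<or> 3 * x - 2 \<in> cantor_set"
proof (cases "x \<le> 1/2")
  case True
  then have "3 * x - 2 \<notin> cantor_level n" for n
    using cantor_level_subset_unit[of n] by auto
  then show ?thesis
    unfolding mem_cantor_set_iff[of x] mem_cantor_level_Suc by (simp add: cantor_set_def)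
next
  case False
  then have "3 * x \<notin> cantor_level n" for n
    using cantor_level_subset_unit[of n] by auto
  then show ?thesis
    unfolding mem_cantor_set_iff[of x] mem_cantor_level_Suc by (simp add: cantor_set_def)
qed

lemma cantor_set_self_similar:
  "cantor_set = (\<lambda>x. x / 3) ` cantor_set \<union> (\<lambda>x. (x + 2) / 3) ` cantor_set"
proof (intro set_eqI)
  fix x
  show "x \<in> cantor_set
      \<longleftrightarrow> x \<in> (\<lambda>x. x / 3) ` cantor_set \<union> (\<lambda>x. (x + 2) / 3) ` cantor_set"
    using mem_cantor_set_unfold[of x] by (simp add: mem_image_left_copy mem_image_right_copy)
qed

section \<open>Distance to the Cantor set\<close>

lemma infdist_cantor_set_left:
  assumes "x \<le> 1"
  shows "infdist (x / 3) cantor_set = infdist x cantor_set / 3"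
proof -
  let ?L = "(\<lambda>x. x / 3) ` cantor_set" and ?R = "(\<lambda>x. (x + 2) / 3) ` cantor_set"
  have "infdist (x / 3) cantor_set = infdist (x / 3) (?L \<union> ?R)"
    by (rule arg_cong[OF cantor_set_self_similar])
  also have "\<dots> = infdist (x / 3) ?L"
  proof (rule infdist_Un_eq_left)
    show "1 / 3 \<in> ?L"
      using one_in_cantor_set by blast
    show "dist (x / 3) (1 / 3) \<le> dist (x / 3) b" if "b \<in> ?R" for b
      using that assms cantor_set_subset_unit by (force simp: dist_real_def)
  qed
  also have "\<dots> = 1 / 3 * infdist x cantor_set"
    using zero_in_cantor_set
    by (intro infdist_similarity_image) (auto simp: dist_real_def abs_if field_simps)
  finally show ?thesis
    by simp
qed

lemma infdist_cantor_set_right: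
  assumes "x \<ge> 0"
  shows "infdist ((x + 2) / 3) cantor_set = infdist x cantor_set / 3"
proof -
  let ?L = "(\<lambda>x. x / 3) ` cantor_set" and ?R = "(\<lambda>x. (x + 2) / 3) ` cantor_set"
  have "infdist ((x + 2) / 3) cantor_set = infdist ((x + 2) / 3) (?R \<union> ?L)"
    by (rule arg_cong[OF trans[OF cantor_set_self_similar Un_commute]])
  also have "\<dots> = infdist ((x + 2) / 3) ?R"
  proof (rule infdist_Un_eq_left)
    show "2 / 3 \<in> ?R"
      using zero_in_cantor_set by force
    show "dist ((x + 2) / 3) (2 / 3) \<le> dist ((x + 2) / 3) b" if "b \<in> ?L" for b
      using that assms cantor_set_subset_unit by (force simp: dist_real_def)
  qed
  also have "\<dots> = 1 / 3 * infdist x cantor_set"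
    using zero_in_cantor_set
    by (intro infdist_similarity_image) (auto simp: dist_real_def abs_if field_simps)
  finally show ?thesis
    by simp
qed

text \<open>On the left third the map \<open>x \<mapsto> frac (3 x)\<close> is \<open>x \<mapsto> 3 x\<close> and on the right third it is
  \<open>x \<mapsto> 3 x - 2\<close>: it inverts whichever scaling produced the copy near \<open>x\<close>.\<close>

lemma infdist_cantor_set_frac:
  assumes "0 \<le> x" "x < 1" "x \<notin> middle_third"
  shows "infdist x cantor_set = infdist (frac (3 * x)) cantor_set / 3"
proof (cases "x < 1/3")
  case True
  then have "frac (3 * x) = 3 * x"
    using assms by (simp add: frac_eq)
  then show ?thesis
    using infdist_cantor_set_left[of "3 * x"] True by simp
next
  case False
  then have "x \<ge> 2/3"
    using assms by (auto simp: middle_third_def)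
  then have "frac (3 * x) = 3 * x - 2"
    using assms by (simp add: frac_unique_iff)
  then show ?thesis
    using infdist_cantor_set_right[of "3 * x - 2"] \<open>x \<ge> 2/3\<close> by simp
qed

lemma infdist_cantor_set_middle_third:
  assumes "x \<in> middle_third"
  shows "infdist x cantor_set = infdist x {1/3, 2/3}"
proof (rule antisym)
  have "1/3 \<in> cantor_set" "2/3 \<in> cantor_set"
    using mem_cantor_set_unfold[of "1/3"] mem_cantor_set_unfold[of "2/3"]
      zero_in_cantor_set one_in_cantor_set by auto
  then show "infdist x cantor_set \<le> infdist x {1/3, 2/3}"
    by (intro infdist_mono) auto
next
  have "infdist x {1/3, 2/3} \<le> dist x c" if "c \<in> cantor_set" for c
  proof -
    have "c \<le> 1/3 \<or> c \<ge> 2/3"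
      using that mem_cantor_set_unfold[of c] cantor_set_subset_unit by force
    then have "dist x (1/3) \<le> dist x c \<or> dist x (2/3) \<le> dist x c"
      using assms by (auto simp: middle_third_def dist_real_def)
    then show ?thesis
      by (auto intro: infdist_le2)
  qed
  then show "infdist x {1/3, 2/3} \<le> infdist x cantor_set"
    using zero_in_cantor_set by (subst (2) infdist_notempty) (auto intro!: cINF_greatest)
qed

section \<open>Following the orbit to the middle third\<close>

lemma theta_Suc: "theta \<alpha> (Suc k) = theta (frac (3 * \<alpha>)) k"
proof -
  have "3 ^ Suc k * \<alpha> = 3 ^ k * frac (3 * \<alpha>) + of_int (3 ^ k * \<lfloor>3 * \<alpha>\<rfloor>)"
    by (simp add: frac_def algebra_simps)
  then show ?thesis
    unfolding theta_def by (simp only: frac_add_of_int_right)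
qed

lemma infdist_cantor_set_first_entry:
  assumes "0 \<le> \<alpha>" "\<alpha> < 1"
    and "theta \<alpha> n \<in> middle_third" "\<And>k. k < n \<Longrightarrow> theta \<alpha> k \<notin> middle_third"
  shows "infdist \<alpha> cantor_set = infdist (theta \<alpha> n) {1/3, 2/3} / 3 ^ n"
  using assms
proof (induction n arbitrary: \<alpha>)
  case 0
  then have "theta \<alpha> 0 = \<alpha>"
    by (simp add: theta_def frac_eq)
  then show ?case
    using infdist_cantor_set_middle_third 0 by simp
next
  case (Suc n)
  let ?\<beta> = "frac (3 * \<alpha>)"
  have "theta \<alpha> 0 = \<alpha>"
    using Suc.prems by (simp add: theta_def frac_eq)
  then have "\<alpha> \<notin> middle_third"
    using Suc.prems(4)[of 0] by simp
  then have "infdist \<alpha> cantor_set = infdist ?\<beta> cantor_set / 3"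
    using infdist_cantor_set_frac Suc.prems by blast
  also have "infdist ?\<beta> cantor_set = infdist (theta ?\<beta> n) {1/3, 2/3} / 3 ^ n"
  proof (rule Suc.IH)
    show "theta ?\<beta> k \<notin> middle_third" if "k < n" for k
      using Suc.prems(4)[of "Suc k"] that by (simp add: theta_Suc)
  qed (use Suc.prems in \<open>simp_all add: theta_Suc frac_lt_1\<close>)
  finally show ?case
    by (simp add: theta_Suc)
qed

lemma exit_time_eq_enatD:
  assumes "exit_time \<alpha> = enat N"
  shows "N \<ge> 1" "theta \<alpha> (N - 1) \<in> middle_third"
    and "k < N - 1 \<Longrightarrow> theta \<alpha> k \<notin> middle_third"
proof -
  let ?S = "{enat N | N. N \<ge> 1 \<and> theta \<alpha> (N - 1) \<in> middle_third}"
  have Inf: "Inf ?S = enat N"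
    using assms by (simp add: exit_time_def)
  have "?S \<noteq> {}"
  proof
    assume "?S = {}"
    with Inf show False
      unfolding Inf_enat_def by simp
  qed
  then have "Inf ?S \<in> ?S"
    by (metis (no_types, lifting) Inf_enat_def LeastI_ex ex_in_conv)
  then have "enat N \<in> ?S"
    unfolding Inf .
  then show "N \<ge> 1" "theta \<alpha> (N - 1) \<in> middle_third"
    by auto
  show "theta \<alpha> k \<notin> middle_third" if "k < N - 1"
  proof
    assume "theta \<alpha> k \<in> middle_third"
    then have "enat (Suc k) \<in> ?S"
      by auto
    then have "Inf ?S \<le> enat (Suc k)"
      by (rule Inf_lower)
    then show False
      using that unfolding Inf by simp
  qed
qed

theorem proposition3p1:
  fixes \<alpha> :: real and N :: nat
  assumes "\<alpha> \<in> {0<..<1} - \<rat>"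
    and "exit_time \<alpha> = enat N"
  shows "infdist \<alpha> cantor_set =
           3 powi (- (int N - 1)) * infdist (theta \<alpha> (N - 1)) {1/3, 2/3}"
proof -
  have "infdist \<alpha> cantor_set = infdist (theta \<alpha> (N - 1)) {1/3, 2/3} / 3 ^ (N - 1)"
    using assms exit_time_eq_enatD[OF assms(2)] by (intro infdist_cantor_set_first_entry) auto
  moreover have "(3::real) powi (- (int N - 1)) = inverse (3 ^ (N - 1))"
  proof -
    have "int N - 1 = int (N - 1)"
      using exit_time_eq_enatD(1)[OF assms(2)] by simp
    then show ?thesis
      by (simp only: power_int_minus power_int_of_nat)
  qed
  ultimately show ?thesis
    by (simp only: divide_inverse mult.commute)
qed

end
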